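(* Let $\mathbb{F}$ be an arbitrary field and let $\mathbf{O}=\mathbf{O}(\mathbb{F})$ be the split-octonion algebra over $\mathbb{F}$. Assume that $f(y)\in\mathbb{F}[y]$ is a non-zero polynomial without constant term, and let $c\in\mathbf{O}\setminus\mathbb{F}1_{\mathbf{O}}$. Let $X\subseteq\mathbf{O}$ be the set of all solutions $x\in\mathbf{O}$ of the equation $f(x)=c$. 1. Assume $\mathrm{char}\,\mathbb{F}\neq2$. Then $x\in X$ if and only if there exist $\lambda,\mu\in\mathbb{F}$ satisfying $$\left\{\begin{array}{rcl}(\lambda^2+4\mu)\widehat{f}(\lambda,\mu)^2&=&\mathrm{tr}(c)^2-4n(c),\\ \lambda\widehat{f}(\lambda,\mu)+2\mu\check{f}(\lambda,\mu)&=&\mathrm{tr}(c),\\ \widehat{f}(\lambda,\mu)&\neq&0,\end{array}\right.$$ such that $$x=\frac{1}{\widehat{f}(\lambda,\mu)}\Big(c-\frac{\mathrm{tr}(c)}{2}1_{\mathbf{O}}\Big)+\frac{\lambda}{2}1_{\mathbf{O}}.$$ 2. Assume $\mathrm{char}\,\mathbb{F}=2$. (a) If $\mathrm{tr}(c)\neq0$, then $x\in X$ if and only if there exist $\lambda\in\mathbb{F}^{\times}$ and $\mu\in\mathbb{F}$ satisfying $$\left\{\begin{array}{rcl}\mu^2\check{f}(\lambda,\mu)^2+\mu\,\mathrm{tr}(c)\,\check{f}(\lambda,\mu)&=&n(c)+\frac{\mu}{\lambda^2}\mathrm{tr}(c)^2,\\ \lambda\widehat{f}(\lambda,\mu)&=&\mathrm{tr}(c),\end{array}\right.$$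 such that $$x=\frac{\lambda}{\mathrm{tr}(c)}\Big(c+\mu\,\check{f}(\lambda,\mu)1_{\mathbf{O}}\Big).$$ (b) If $\mathrm{tr}(c)=0$, then $x\in X$ if and only if there exists $\mu\in\mathbb{F}$ satisfying $$\left\{\begin{array}{rcl}\mu\widehat{f}(0,\mu)^2+\mu^2\check{f}(0,\mu)^2&=&n(c),\\ \widehat{f}(0,\mu)&\neq&0,\end{array}\right.$$ such that $$x=\frac{1}{\widehat{f}(0,\mu)}\Big(c+\mu\,\check{f}(0,\mu)1_{\mathbf{O}}\Big).$$ Moreover, in each case $\mathrm{tr}(x)=\lambda$ and $n(x)=-\mu$, where in case 2(b) $\lambda=0$.
   Context: $\mathbb{F}$ is a field (possibly finite) of arbitrary characteristic; $\mathbb{F}^{\times}$ is the set of its non-zero elements. The split-octonion algebra $\mathbf{O}=\mathbf{O}(\mathbb{F})$ is the $8$-dimensional vector space of all matrices $a=\begin{pmatrix}\alpha&\mathbf{u}\\ \mathbf{v}&\beta\end{pmatrix}$ with $\alpha,\beta\in\mathbb{F}$ and vectors $\mathbf{u},\mathbf{v}\in\mathbb{F}^3$, with multiplication $$aa'=\begin{pmatrix}\alpha\alpha'+\mathbf{u}\cdot\mathbf{v}'&\alpha\mathbf{u}'+\beta'\mathbf{u}-\mathbf{v}\times\mathbf{v}'\\ \alpha'\mathbf{v}+\beta\mathbf{v}'+\mathbf{u}\times\mathbf{u}'&\beta\beta'+\mathbf{v}\cdot\mathbf{u}'\end{pmatrix},\qquad a'=\begin{pmatrix}\alpha'&\mathbf{u}'\\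 \mathbf{v}'&\beta'\end{pmatrix},$$ where $\cdot$ and $\times$ are the usual dot and cross products on $\mathbb{F}^3$. The unity $1_{\mathbf{O}}$ is the element with $\alpha=\beta=1$, $\mathbf{u}=\mathbf{v}=\mathbf{0}$. The trace is $\mathrm{tr}(a)=\alpha+\beta$ and the norm is $n(a)=\alpha\beta-\mathbf{u}\cdot\mathbf{v}$. The algebra is alternative, hence power-associative, so powers $x^k$ are well defined; for $f(y)=\alpha_ny^n+\cdots+\alpha_1y$ put $f(x)=\alpha_nx^n+\cdots+\alpha_1x\in\mathbf{O}$. Polynomials $p_k(y,z)\in\mathbb{F}[y,z]$, $k\ge -1$, are defined by $p_{-1}=0$, $p_0=1$, $p_{k+1}=yp_k+zp_{k-1}$ for $k\ge 0$. For a non-zero polynomial without constant term $f(y)=\alpha_ny^n+\cdots+\alpha_1y\in\mathbb{F}[y]$ ($n\ge1$, $\alpha_n\ne0$), define $$\widehat{f}(y,z)=\sum_{k=1}^n\alpha_kp_{k-1}(y,z),\qquad \check{f}(y,z)=\sum_{k=1}^n\alpha_kp_{k-2}(y,z).$$ *)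

theory Defs
  imports "HOL-Analysis.Cartesian_Space" "HOL-Computational_Algebra.Computational_Algebra"
begin

section \<open>Split octonions\<close>

text \<open>The library's cross product is available on \<open>real^3\<close> only.\<close>

definition cross :: "'a::comm_ring_1 ^ 3 \<Rightarrow> 'a ^ 3 \<Rightarrow> 'a ^ 3" where
  "cross u v = vector [u$2 * v$3 - u$3 * v$2,
                       u$3 * v$1 - u$1 * v$3,
                       u$1 * v$2 - u$2 * v$1]"

text \<open>\<open>Oct \<alpha> u v \<beta>\<close> is the matrix with rows \<open>(\<alpha>, u)\<close> and \<open>(v, \<beta>)\<close>.\<close>

datatype 'a octonion = Oct (oct_a: 'a) (oct_u: "'a ^ 3") (oct_v: "'a ^ 3") (oct_b: 'a)

instantiation octonion :: (ab_group_add) ab_group_add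
begin

definition "0 = Oct 0 0 0 0"
definition "x + y = Oct (oct_a x + oct_a y) (oct_u x + oct_u y) (oct_v x + oct_v y) (oct_b x + oct_b y)"
definition "- x = Oct (- oct_a x) (- oct_u x) (- oct_v x) (- oct_b x)"
definition "x - y = Oct (oct_a x - oct_a y) (oct_u x - oct_u y) (oct_v x - oct_v y) (oct_b x - oct_b y)"

instance
  by standard
    (simp_all add: zero_octonion_def plus_octonion_def uminus_octonion_def minus_octonion_def
      octonion.expand algebra_simps)

end

definition oct_scale :: "'a::comm_ring_1 \<Rightarrow> 'a octonion \<Rightarrow> 'a octonion" (infixr \<open>*\<^sub>O\<close> 75) where
  "r *\<^sub>O x = Oct (r * oct_a x) (r *s oct_u x) (r *s oct_v x) (r * oct_b x)"

text \<open>
  Since the product is not associative, there is no ring class to instantiate. Class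
  \<^class>\<open>power\<close> asks for no laws; it gives \<open>x ^ 0 = 1\<close> and \<open>x ^ Suc n = x * x ^ n\<close>. The lemma
  \<open>oct_power_add\<close> below shows that the bracketing does not matter.
\<close>

instantiation octonion :: (comm_ring_1) power
begin

definition "1 = Oct 1 0 0 1"
definition "x * y =
  Oct (oct_a x * oct_a y + scalar_product (oct_u x) (oct_v y))
      (oct_a x *s oct_u y + oct_b y *s oct_u x - cross (oct_v x) (oct_v y))
      (oct_a y *s oct_v x + oct_b x *s oct_v y + cross (oct_u x) (oct_u y))
      (oct_b x * oct_b y + scalar_product (oct_v x) (oct_u y))"

instance ..

end

definition oct_tr :: "'a::comm_ring_1 octonion \<Rightarrow> 'a" where
  "oct_tr x = oct_a x + oct_b x"

definition oct_norm :: "'a::comm_ring_1 octonion \<Rightarrow> 'a" where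
  "oct_norm x = oct_a x * oct_b x - scalar_product (oct_u x) (oct_v x)"

text \<open>The value \<open>f(x)\<close>; only meant for polynomials without constant term.\<close>

definition oct_poly :: "'a::comm_ring_1 poly \<Rightarrow> 'a octonion \<Rightarrow> 'a octonion" where
  "oct_poly f x = (\<Sum>k=1..degree f. coeff f k *\<^sub>O x ^ k)"

lemmas octonion_defs = zero_octonion_def plus_octonion_def uminus_octonion_def
  minus_octonion_def one_octonion_def times_octonion_def oct_scale_def

lemma oct_vector_space: "vector_space ((*\<^sub>O) :: 'a::field \<Rightarrow> 'a octonion \<Rightarrow> 'a octonion)"
  by standard
    (auto simp: octonion_defs algebra_simps vec_eq_iff)

lemma oct_mult_1: "1 * x = x" "x * 1 = x" for x :: "'a::comm_ring_1 octonion"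
  by (auto simp: octonion_defs octonion.expand scalar_product_def cross_def vec_eq_iff forall_3 sum_3)

lemma oct_left_alternative: "x * (x * y) = (x * x) * y" for x y :: "'a::comm_ring_1 octonion"
  by (simp add: octonion_defs scalar_product_def cross_def vec_eq_iff forall_3 sum_3 algebra_simps)

lemma oct_right_alternative: "(y * x) * x = y * (x * x)" for x y :: "'a::comm_ring_1 octonion"
  by (simp add: octonion_defs scalar_product_def cross_def vec_eq_iff forall_3 sum_3 algebra_simps)

lemma oct_quadratic: "x * x = oct_tr x *\<^sub>O x - oct_norm x *\<^sub>O 1" for x :: "'a::comm_ring_1 octonion"
  by (simp add: octonion_defs oct_tr_def oct_norm_def scalar_product_def cross_def vec_eq_iff
      forall_3 sum_3 algebra_simps)

lemma oct_bilinear: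
  fixes x y z :: "'a::comm_ring_1 octonion"
  shows "(x + y) * z = x * z + y * z" "x * (y + z) = x * y + x * z"
    "(r *\<^sub>O x) * y = r *\<^sub>O (x * y)" "x * (r *\<^sub>O y) = r *\<^sub>O (x * y)"
  by (simp_all add: octonion_defs scalar_product_def cross_def vec_eq_iff forall_3 sum_3 algebra_simps)

lemma oct_power_span: "\<exists>r s. x ^ n = r *\<^sub>O x + s *\<^sub>O 1" for x :: "'a::comm_ring_1 octonion"
proof (induction n)
  case 0
  have "x ^ 0 = 0 *\<^sub>O x + 1 *\<^sub>O 1"
    by (simp add: octonion_defs vec_eq_iff)
  then show ?case by blast
next
  case (Suc n)
  then obtain r s where "x ^ n = r *\<^sub>O x + s *\<^sub>O 1" by blast
  then have "x ^ Suc n = r *\<^sub>O (oct_tr x *\<^sub>O x - oct_norm x *\<^sub>O 1) + s *\<^sub>O x"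
    by (simp add: oct_bilinear oct_mult_1 oct_quadratic)
  also have "\<dots> = (r * oct_tr x + s) *\<^sub>O x + (- (r * oct_norm x)) *\<^sub>O 1"
    by (simp add: octonion_defs vec_eq_iff algebra_simps)
  finally show ?case by blast
qed

lemma oct_power_add: "x ^ (m + n) = x ^ m * x ^ n" for x :: "'a::comm_ring_1 octonion"
proof (induction m)
  case 0
  then show ?case by (simp add: oct_mult_1)
next
  case (Suc m)
  obtain r s where "x ^ m = r *\<^sub>O x + s *\<^sub>O 1" using oct_power_span by blast
  then have "x * (x ^ m * x ^ n) = (x * x ^ m) * x ^ n"
    by (simp add: oct_bilinear oct_mult_1 oct_left_alternative)
  with Suc show ?case by simp
qed


section \<open>The polynomials associated with \<open>f\<close>\<close>

text \<open>Bivariate polynomials over \<open>F\<close> in \<open>y\<close>, \<open>z\<close> are elements of \<open>F[y][z]\<close>.\<close>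

abbreviation var_y :: "'a::comm_ring_1 poly poly" where "var_y \<equiv> [:[:0, 1:]:]"
abbreviation var_z :: "'a::comm_ring_1 poly poly" where "var_z \<equiv> [:0, 1:]"

definition poly2 :: "'a::comm_ring_1 poly poly \<Rightarrow> 'a \<Rightarrow> 'a \<Rightarrow> 'a" where
  "poly2 p y z = poly (poly p [:z:]) y"

text \<open>Indices are shifted by one: \<open>pp k\<close> is \<open>p\<^bsub>k-1\<^esub>\<close>, so that \<open>pp 0\<close> is \<open>p\<^bsub>-1\<^esub>\<close>.\<close>

fun pp :: "nat \<Rightarrow> 'a::comm_ring_1 poly poly" where
  "pp 0 = 0"
| "pp (Suc 0) = 1"
| "pp (Suc (Suc k)) = var_y * pp (Suc k) + var_z * pp k"

definition hat_poly :: "'a::comm_ring_1 poly \<Rightarrow> 'a poly poly" where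
  "hat_poly f = (\<Sum>k=1..degree f. smult [:coeff f k:] (pp k))"

definition check_poly :: "'a::comm_ring_1 poly \<Rightarrow> 'a poly poly" where
  "check_poly f = (\<Sum>k=1..degree f. smult [:coeff f k:] (pp (k - 1)))"

abbreviation f_hat :: "'a::comm_ring_1 poly \<Rightarrow> 'a \<Rightarrow> 'a \<Rightarrow> 'a" where
  "f_hat f \<equiv> poly2 (hat_poly f)"

abbreviation f_check :: "'a::comm_ring_1 poly \<Rightarrow> 'a \<Rightarrow> 'a \<Rightarrow> 'a" where
  "f_check f \<equiv> poly2 (check_poly f)"

end

theory Submission
  imports Defs
begin

text \<open>
  Since \<open>x\<^sup>2 = tr(x) x - n(x)\<close>, every power of \<open>x\<close> is \<open>x\<^sup>k = p\<^bsub>k-1\<^esub>(\<kappa>, \<mu>) x + \<mu> p\<^bsub>k-2\<^esub>(\<kappa>, \<mu>)\<close>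
  with \<open>\<kappa> = tr(x)\<close> and \<open>\<mu> = -n(x)\<close>. Hence \<open>f(x) = c\<close> is an affine equation in \<open>x\<close> with leading
  coefficient the value of \<open>f_hat\<close>, nonzero because \<open>c\<close> is not a scalar. Solving for \<open>x\<close> and
  requiring that the solution have trace \<open>\<kappa>\<close> and norm \<open>-\<mu>\<close> gives one system of equations valid
  in every characteristic; the three cases only rewrite this system.
\<close>

section \<open>Affine combinations with the unity\<close>

lemma oct_tr_affine: "oct_tr (r *\<^sub>O x + s *\<^sub>O 1) = r * oct_tr x + 2 * s"
  by (simp add: octonion_defs oct_tr_def algebra_simps)

text \<open>The norm is a quadratic form whose polar form against the unity is the trace; this
  produces the mixed term.\<close>

lemma oct_norm_affine:
  "oct_norm (r *\<^sub>O x + s *\<^sub>O 1) = r\<^sup>2 * oct_norm x + r * s * oct_tr x + s\<^sup>2"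
  by (simp add: octonion_defs oct_tr_def oct_norm_def scalar_product_def sum_3
      power2_eq_square algebra_simps)

lemma oct_affine_eq_iff:
  fixes x c :: "'a::field octonion"
  assumes "h \<noteq> 0"
  shows "h *\<^sub>O x + b *\<^sub>O 1 = c \<longleftrightarrow> x = (1 / h) *\<^sub>O c + (- b / h) *\<^sub>O 1"
  using assms by (cases x; cases c) (auto simp: octonion_defs vec_eq_iff field_simps)

section \<open>Values of \<open>f\<close> and the characteristic-free system\<close>

lemma poly2_simps:
  "poly2 0 y z = 0" "poly2 1 y z = 1"
  "poly2 (p + q) y z = poly2 p y z + poly2 q y z"
  "poly2 (p * q) y z = poly2 p y z * poly2 q y z"
  "poly2 (smult [:a:] p) y z = a * poly2 p y z"
  "poly2 (\<Sum>i\<in>A. g i) y z = (\<Sum>i\<in>A. poly2 (g i) y z)"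
  "poly2 var_y y z = y" "poly2 var_z y z = z"
  by (simp_all add: poly2_def poly_sum)

text \<open>Multiplying r x + s by x and reducing with \<open>oct_quadratic\<close> sends (r, s) to
  (tr(x) r + s, -n(x) r), which is the recurrence of \<open>pp\<close> at y = tr(x), z = -n(x).
  Exponents start at 1 because the constant part of x ^ 0 would call for the index -2.\<close>

lemma oct_power_pp:
  fixes x :: "'a::comm_ring_1 octonion"
  shows "x ^ Suc k = poly2 (pp (Suc k)) (oct_tr x) (- oct_norm x) *\<^sub>O x
    + (- oct_norm x * poly2 (pp k) (oct_tr x) (- oct_norm x)) *\<^sub>O 1"
proof (induction k)
  case 0
  then show ?case
    by (simp add: oct_mult_1 poly2_simps) (simp add: octonion_defs vec_eq_iff)
next
  case (Suc k)
  let ?p = "\<lambda>k. poly2 (pp k) (oct_tr x) (- oct_norm x)"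
  have "x ^ Suc (Suc k) = x * x ^ Suc k"
    by simp
  also have "\<dots> = x * (?p (Suc k) *\<^sub>O x + (- oct_norm x * ?p k) *\<^sub>O 1)"
    by (simp only: Suc.IH)
  also have "\<dots> = ?p (Suc k) *\<^sub>O (oct_tr x *\<^sub>O x - oct_norm x *\<^sub>O 1) + (- oct_norm x * ?p k) *\<^sub>O x"
    by (simp add: oct_bilinear oct_mult_1 oct_quadratic)
  also have "\<dots> = (oct_tr x * ?p (Suc k) + - oct_norm x * ?p k) *\<^sub>O x + (- oct_norm x * ?p (Suc k)) *\<^sub>O 1"
    by (simp add: octonion_defs vec_eq_iff algebra_simps)
  finally show ?case
    by (simp only: pp.simps poly2_simps)
qed

lemma oct_poly_affine:
  fixes x :: "'a::field octonion"
  shows "oct_poly f x = f_hat f (oct_tr x) (- oct_norm x) *\<^sub>O x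
    + (- oct_norm x * f_check f (oct_tr x) (- oct_norm x)) *\<^sub>O 1"
proof -
  interpret vector_space "(*\<^sub>O) :: 'a \<Rightarrow> 'a octonion \<Rightarrow> 'a octonion"
    by (rule oct_vector_space)
  let ?p = "\<lambda>k. poly2 (pp k) (oct_tr x) (- oct_norm x)"
  \<comment> \<open>The range gives k \<ge> 1, so the truncated \<open>k - 1\<close> is a true
    predecessor and \<open>Suc (k - 1)\<close> is k.\<close>
  have power: "x ^ k = ?p k *\<^sub>O x + (- oct_norm x * ?p (k - 1)) *\<^sub>O 1" if "k \<in> {1..degree f}" for k
    using oct_power_pp[of x "k - 1"] that by (simp del: power.simps)
  have "oct_poly f x = (\<Sum>k=1..degree f.
      (coeff f k * ?p k) *\<^sub>O x + (- oct_norm x * (coeff f k * ?p (k - 1))) *\<^sub>O 1)"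
    unfolding oct_poly_def
    by (intro sum.cong refl) (simp only: power scale_right_distrib scale_scale mult.left_commute)
  then show ?thesis
    by (simp only: sum.distrib scale_sum_left[symmetric] sum_distrib_left[symmetric]
        hat_poly_def check_poly_def poly2_simps)
qed

text \<open>Here \<kappa> is the parameter lambda. The last clause solves the affine equation for x;
  the two middle clauses state, with denominators cleared, that this x has trace \<kappa> and norm
  -\<mu>. Nothing is divided by 2.\<close>

definition oct_sol :: "'a::field poly \<Rightarrow> 'a octonion \<Rightarrow> 'a \<Rightarrow> 'a \<Rightarrow> 'a octonion \<Rightarrow> bool" where
  "oct_sol f c \<kappa> \<mu> x \<longleftrightarrow>
    f_hat f \<kappa> \<mu> \<noteq> 0 \<and>
    oct_tr c = \<kappa> * f_hat f \<kappa> \<mu> + 2 * \<mu> * f_check f \<kappa> \<mu> \<and>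
    oct_norm c - \<mu> * f_check f \<kappa> \<mu> * oct_tr c + \<mu>\<^sup>2 * (f_check f \<kappa> \<mu>)\<^sup>2 = - \<mu> * (f_hat f \<kappa> \<mu>)\<^sup>2 \<and>
    x = (1 / f_hat f \<kappa> \<mu>) *\<^sub>O c + (- (\<mu> * f_check f \<kappa> \<mu>) / f_hat f \<kappa> \<mu>) *\<^sub>O 1"

text \<open>This consistency carries the converse direction: the system evaluates
  \<open>f_hat\<close> and \<open>f_check\<close> at (\<kappa>, \<mu>), whereas f(x) needs their
  values at (tr(x), -n(x)). It also yields the trace and norm claims of all three cases.\<close>

lemma oct_sol_tr_norm:
  assumes "oct_sol f c \<kappa> \<mu> x"
  shows "oct_tr x = \<kappa>" "oct_norm x = - \<mu>"
proof -
  define h k where "h = f_hat f \<kappa> \<mu>" and "k = f_check f \<kappa> \<mu>"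
  have h: "h \<noteq> 0" and t: "oct_tr c = \<kappa> * h + 2 * \<mu> * k"
    and n: "oct_norm c - \<mu> * k * oct_tr c + \<mu>\<^sup>2 * k\<^sup>2 = - \<mu> * h\<^sup>2"
    and x: "x = (1 / h) *\<^sub>O c + (- (\<mu> * k) / h) *\<^sub>O 1"
    using assms unfolding oct_sol_def h_def k_def by blast+
  show "oct_tr x = \<kappa>"
    using h by (simp add: x oct_tr_affine t field_simps)
  have "oct_norm x = (oct_norm c - \<mu> * k * oct_tr c + \<mu>\<^sup>2 * k\<^sup>2) / h\<^sup>2"
    using h by (simp add: x oct_norm_affine power2_eq_square field_simps)
  also have "\<dots> = - \<mu>"
    unfolding n using h by simp
  finally show "oct_norm x = - \<mu>" .
qed

lemma oct_poly_eq_iff_sol: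
  fixes c :: "'a::field octonion"
  assumes c: "c \<notin> range (\<lambda>r. r *\<^sub>O 1)"
  shows "oct_poly f x = c \<longleftrightarrow> (\<exists>\<kappa> \<mu>. oct_sol f c \<kappa> \<mu> x)"
proof
  define \<kappa> \<mu> h k where "\<kappa> = oct_tr x" and "\<mu> = - oct_norm x"
    and "h = f_hat f \<kappa> \<mu>" and "k = f_check f \<kappa> \<mu>"
  assume "oct_poly f x = c"
  then have eq: "h *\<^sub>O x + (\<mu> * k) *\<^sub>O 1 = c"
    by (simp add: oct_poly_affine h_def k_def \<mu>_def \<kappa>_def)
  have "h \<noteq> 0"
  proof
    assume "h = 0"
    with eq have "c = (\<mu> * k) *\<^sub>O 1"
      by (auto simp: octonion_defs)
    with c show False by blast
  qed
  moreover from this have "x = (1 / h) *\<^sub>O c + (- (\<mu> * k) / h) *\<^sub>O 1"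
    using eq by (simp add: oct_affine_eq_iff)
  moreover have t: "oct_tr c = \<kappa> * h + 2 * \<mu> * k"
    by (simp add: eq[symmetric] oct_tr_affine \<kappa>_def)
  moreover have "oct_norm c - \<mu> * k * oct_tr c + \<mu>\<^sup>2 * k\<^sup>2 = - \<mu> * h\<^sup>2"
  proof -
    \<comment> \<open>Take norms in \<open>eq\<close>; after substituting \<open>t\<close> for
      tr(c), all terms containing k cancel.\<close>
    have "oct_norm c = - \<mu> * h\<^sup>2 + h * (\<mu> * k) * \<kappa> + (\<mu> * k)\<^sup>2"
      by (simp add: eq[symmetric] oct_norm_affine \<kappa>_def \<mu>_def)
    then show ?thesis
      unfolding t by (simp add: power2_eq_square algebra_simps)
  qed
  ultimately have "oct_sol f c \<kappa> \<mu> x"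
    by (simp add: oct_sol_def h_def k_def)
  then show "\<exists>\<kappa> \<mu>. oct_sol f c \<kappa> \<mu> x" by blast
next
  assume "\<exists>\<kappa> \<mu>. oct_sol f c \<kappa> \<mu> x"
  then obtain \<kappa> \<mu> where sol: "oct_sol f c \<kappa> \<mu> x" by blast
  then have "f_hat f \<kappa> \<mu> *\<^sub>O x + (\<mu> * f_check f \<kappa> \<mu>) *\<^sub>O 1 = c"
    unfolding oct_sol_def by (subst oct_affine_eq_iff) blast+
  then show "oct_poly f x = c"
    by (simp add: oct_poly_affine oct_sol_tr_norm[OF sol])
qed

section \<open>The system in each characteristic\<close>

lemma field_two_eq_0_iff: "(2 :: 'a::field) = 0 \<longleftrightarrow> CHAR('a) = 2"
proof
  assume "(2 :: 'a) = 0"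
  then have "of_nat 2 = (0 :: 'a)" by simp
  then have "CHAR('a) dvd 2"
    by (simp only: of_nat_eq_0_iff_char_dvd)
  then have "CHAR('a) = 1 \<or> CHAR('a) = 2"
    using two_is_prime_nat unfolding prime_nat_iff by blast
  then show "CHAR('a) = 2"
    using CHAR_not_1[where ?'a = 'a] by simp
next
  assume "CHAR('a) = 2"
  then show "(2 :: 'a) = 0"
    using of_nat_CHAR[where ?'a = 'a] by simp
qed

lemma char2_neg_eq: "- a = a" if "CHAR('a) = 2" for a :: "'a::field"
proof -
  have "a + a = 2 * a" by simp
  also have "\<dots> = 0" using that field_two_eq_0_iff by auto
  finally show ?thesis by (simp add: neg_eq_iff_add_eq_0)
qed

text \<open>The discriminant tr^2 - 4 n is invariant under adding scalars and scales by squares, so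
  the first equation compares the discriminants of c and x, and \<open>f_check\<close> drops out. In
  the formula for x, the trace equation eliminates \<open>f_check\<close> as well.\<close>

lemma oct_sol_char_not_2:
  fixes c :: "'a::field octonion"
  assumes "CHAR('a) \<noteq> 2"
  shows "oct_sol f c \<kappa> \<mu> x \<longleftrightarrow>
    (\<kappa>\<^sup>2 + 4 * \<mu>) * (f_hat f \<kappa> \<mu>)\<^sup>2 = (oct_tr c)\<^sup>2 - 4 * oct_norm c \<and>
    \<kappa> * f_hat f \<kappa> \<mu> + 2 * \<mu> * f_check f \<kappa> \<mu> = oct_tr c \<and>
    f_hat f \<kappa> \<mu> \<noteq> 0 \<and>
    x = (1 / f_hat f \<kappa> \<mu>) *\<^sub>O (c - (oct_tr c / 2) *\<^sub>O 1) + (\<kappa> / 2) *\<^sub>O 1"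
proof -
  define h k where "h = f_hat f \<kappa> \<mu>" and "k = f_check f \<kappa> \<mu>"
  have two: "(2 :: 'a) \<noteq> 0"
    using assms field_two_eq_0_iff by auto
  have four: "(4 :: 'a) \<noteq> 0"
  proof -
    have "(4 :: 'a) = 2 * 2" by simp
    with two show ?thesis by (metis mult_eq_0_iff)
  qed
  have "oct_norm c - \<mu> * k * oct_tr c + \<mu>\<^sup>2 * k\<^sup>2 = - \<mu> * h\<^sup>2 \<longleftrightarrow>
      (\<kappa>\<^sup>2 + 4 * \<mu>) * h\<^sup>2 = (oct_tr c)\<^sup>2 - 4 * oct_norm c"
    if t: "oct_tr c = \<kappa> * h + 2 * \<mu> * k"
  proof -
    \<comment> \<open>Modulo the trace equation, the discriminant condition is 4 times the norm
      condition, and 4 is invertible.\<close>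
    have "(\<kappa>\<^sup>2 + 4 * \<mu>) * h\<^sup>2 - ((oct_tr c)\<^sup>2 - 4 * oct_norm c) =
        4 * (oct_norm c - \<mu> * k * oct_tr c + \<mu>\<^sup>2 * k\<^sup>2 - - \<mu> * h\<^sup>2)"
      unfolding t by (simp add: power2_eq_square algebra_simps)
    then show ?thesis
      using four by (metis eq_iff_diff_eq_0 mult_eq_0_iff)
  qed
  moreover have "(1 / h) *\<^sub>O (c - (oct_tr c / 2) *\<^sub>O 1) + (\<kappa> / 2) *\<^sub>O 1 =
      (1 / h) *\<^sub>O c + (- (\<mu> * k) / h) *\<^sub>O 1"
    if "h \<noteq> 0" and t: "oct_tr c = \<kappa> * h + 2 * \<mu> * k"
  proof -
    have "(1 / h) *\<^sub>O (c - (oct_tr c / 2) *\<^sub>O 1) + (\<kappa> / 2) *\<^sub>O 1 =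
        (1 / h) *\<^sub>O c + (\<kappa> / 2 - oct_tr c / (2 * h)) *\<^sub>O 1"
      by (simp add: octonion_defs vec_eq_iff algebra_simps)
    also have "\<kappa> / 2 - oct_tr c / (2 * h) = - (\<mu> * k) / h"
      unfolding t using that(1) two by (simp add: field_simps)
    finally show ?thesis .
  qed
  ultimately show ?thesis
    unfolding oct_sol_def h_def[symmetric] k_def[symmetric] by auto
qed

text \<open>All signs become irrelevant, and the summand with factor 2 leaves the trace
  equation.\<close>

lemma oct_sol_char_2:
  fixes c :: "'a::field octonion"
  assumes char: "CHAR('a) = 2"
  shows "oct_sol f c \<kappa> \<mu> x \<longleftrightarrow>
    f_hat f \<kappa> \<mu> \<noteq> 0 \<and>
    \<kappa> * f_hat f \<kappa> \<mu> = oct_tr c \<and>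
    \<mu>\<^sup>2 * (f_check f \<kappa> \<mu>)\<^sup>2 + \<mu> * oct_tr c * f_check f \<kappa> \<mu> = oct_norm c + \<mu> * (f_hat f \<kappa> \<mu>)\<^sup>2 \<and>
    x = (1 / f_hat f \<kappa> \<mu>) *\<^sub>O (c + (\<mu> * f_check f \<kappa> \<mu>) *\<^sub>O 1)"
proof -
  define h k where "h = f_hat f \<kappa> \<mu>" and "k = f_check f \<kappa> \<mu>"
  have two: "(2 :: 'a) = 0"
    using char field_two_eq_0_iff by auto
  note neg = char2_neg_eq[OF char]
  have sub: "a - b = a + b" for a b :: 'a
    using neg[of b] by (metis diff_conv_add_uminus)
  have "oct_norm c - \<mu> * k * oct_tr c + \<mu>\<^sup>2 * k\<^sup>2 = - \<mu> * h\<^sup>2 \<longleftrightarrow>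
      \<mu>\<^sup>2 * k\<^sup>2 + \<mu> * oct_tr c * k = oct_norm c + \<mu> * h\<^sup>2"
  proof -
    \<comment> \<open>With every minus read as plus, both sides are the same sum up to
      order.\<close>
    have "oct_norm c - \<mu> * k * oct_tr c + \<mu>\<^sup>2 * k\<^sup>2 - (- \<mu> * h\<^sup>2) =
      \<mu>\<^sup>2 * k\<^sup>2 + \<mu> * oct_tr c * k - (oct_norm c + \<mu> * h\<^sup>2)"
      unfolding sub neg by (simp add: algebra_simps)
    then show ?thesis
      by (metis eq_iff_diff_eq_0)
  qed
  moreover have "(1 / h) *\<^sub>O c + (- (\<mu> * k) / h) *\<^sub>O 1 = (1 / h) *\<^sub>O (c + (\<mu> * k) *\<^sub>O 1)"
    unfolding neg by (simp add: octonion_defs vec_eq_iff algebra_simps)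
  ultimately show ?thesis
    unfolding oct_sol_def h_def[symmetric] k_def[symmetric] by (auto simp: two)
qed

text \<open>Since tr(c) is a nonzero product of \<kappa> and the value of \<open>f_hat\<close>, both
  factors are nonzero, and the latter can be replaced by tr(c) / \<kappa>.\<close>

lemma oct_sol_char_2_tr_nonzero:
  fixes c :: "'a::field octonion"
  assumes "CHAR('a) = 2" and t: "oct_tr c \<noteq> 0"
  shows "oct_sol f c \<kappa> \<mu> x \<longleftrightarrow>
    \<kappa> \<noteq> 0 \<and>
    \<mu>\<^sup>2 * (f_check f \<kappa> \<mu>)\<^sup>2 + \<mu> * oct_tr c * f_check f \<kappa> \<mu> = oct_norm c + \<mu> / \<kappa>\<^sup>2 * (oct_tr c)\<^sup>2 \<and>
    \<kappa> * f_hat f \<kappa> \<mu> = oct_tr c \<and>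
    x = (\<kappa> / oct_tr c) *\<^sub>O (c + (\<mu> * f_check f \<kappa> \<mu>) *\<^sub>O 1)"
proof (cases "\<kappa> * f_hat f \<kappa> \<mu> = oct_tr c")
  case True
  then have nz: "\<kappa> \<noteq> 0" "f_hat f \<kappa> \<mu> \<noteq> 0"
    using t by auto
  have "\<kappa> / oct_tr c = 1 / f_hat f \<kappa> \<mu>" "\<mu> / \<kappa>\<^sup>2 * (oct_tr c)\<^sup>2 = \<mu> * (f_hat f \<kappa> \<mu>)\<^sup>2"
    using nz by (simp_all add: True[symmetric] power_mult_distrib)
  with True nz show ?thesis
    by (simp add: oct_sol_char_2[OF assms(1)])
next
  \<comment> \<open>Both sides of the equivalence contain the trace equation, so both are
    false.\<close>
  case False
  then show ?thesis
    by (simp add: oct_sol_char_2[OF assms(1)])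
qed

text \<open>The trace equation now says that \<kappa> times a nonzero value of \<open>f_hat\<close>
  is 0, which forces \<kappa> = 0.\<close>

lemma oct_sol_char_2_tr_zero:
  fixes c :: "'a::field octonion"
  assumes "CHAR('a) = 2" and t: "oct_tr c = 0"
  shows "oct_sol f c \<kappa> \<mu> x \<longleftrightarrow>
    \<kappa> = 0 \<and>
    \<mu> * (f_hat f 0 \<mu>)\<^sup>2 + \<mu>\<^sup>2 * (f_check f 0 \<mu>)\<^sup>2 = oct_norm c \<and>
    f_hat f 0 \<mu> \<noteq> 0 \<and>
    x = (1 / f_hat f 0 \<mu>) *\<^sub>O (c + (\<mu> * f_check f 0 \<mu>) *\<^sub>O 1)"
proof -
  \<comment> \<open>In characteristic 2 a summand changes sides without changing sign.\<close>
  have move: "a = b + d \<longleftrightarrow> d + a = b" for a b d :: 'a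
    using char2_neg_eq[OF assms(1), of d] by (metis add.commute add_diff_cancel diff_conv_add_uminus)
  show ?thesis
    by (auto simp: oct_sol_char_2[OF assms(1)] t move)
qed

theorem corollary3p4:
  fixes f :: "'a::field poly" and c :: "'a octonion" and X :: "'a octonion set"
  assumes f_nonzero: "f \<noteq> 0" and f_const: "coeff f 0 = 0"
    and c: "c \<notin> range (\<lambda>r. r *\<^sub>O 1)"
    and X: "X = {x. oct_poly f x = c}"
  shows
    "(CHAR('a) \<noteq> 2 \<longrightarrow>
      (\<forall>x. x \<in> X \<longleftrightarrow> (\<exists>\<kappa> \<mu>.
          (\<kappa>\<^sup>2 + 4 * \<mu>) * (f_hat f \<kappa> \<mu>)\<^sup>2 = (oct_tr c)\<^sup>2 - 4 * oct_norm c \<and>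
          \<kappa> * f_hat f \<kappa> \<mu> + 2 * \<mu> * f_check f \<kappa> \<mu> = oct_tr c \<and>
          f_hat f \<kappa> \<mu> \<noteq> 0 \<and>
          x = (1 / f_hat f \<kappa> \<mu>) *\<^sub>O (c - (oct_tr c / 2) *\<^sub>O 1) + (\<kappa> / 2) *\<^sub>O 1)) \<and>
      (\<forall>x \<kappa> \<mu>.
          (\<kappa>\<^sup>2 + 4 * \<mu>) * (f_hat f \<kappa> \<mu>)\<^sup>2 = (oct_tr c)\<^sup>2 - 4 * oct_norm c \<and>
          \<kappa> * f_hat f \<kappa> \<mu> + 2 * \<mu> * f_check f \<kappa> \<mu> = oct_tr c \<and>
          f_hat f \<kappa> \<mu> \<noteq> 0 \<and>
          x = (1 / f_hat f \<kappa> \<mu>) *\<^sub>O (c - (oct_tr c / 2) *\<^sub>O 1) + (\<kappa> / 2) *\<^sub>O 1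
          \<longrightarrow> oct_tr x = \<kappa> \<and> oct_norm x = - \<mu>)) \<and>
    (CHAR('a) = 2 \<and> oct_tr c \<noteq> 0 \<longrightarrow>
      (\<forall>x. x \<in> X \<longleftrightarrow> (\<exists>\<kappa> \<mu>. \<kappa> \<noteq> 0 \<and>
          \<mu>\<^sup>2 * (f_check f \<kappa> \<mu>)\<^sup>2 + \<mu> * oct_tr c * f_check f \<kappa> \<mu> = oct_norm c + \<mu> / \<kappa>\<^sup>2 * (oct_tr c)\<^sup>2 \<and>
          \<kappa> * f_hat f \<kappa> \<mu> = oct_tr c \<and>
          x = (\<kappa> / oct_tr c) *\<^sub>O (c + (\<mu> * f_check f \<kappa> \<mu>) *\<^sub>O 1))) \<and>
      (\<forall>x \<kappa> \<mu>. \<kappa> \<noteq> 0 \<and>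
          \<mu>\<^sup>2 * (f_check f \<kappa> \<mu>)\<^sup>2 + \<mu> * oct_tr c * f_check f \<kappa> \<mu> = oct_norm c + \<mu> / \<kappa>\<^sup>2 * (oct_tr c)\<^sup>2 \<and>
          \<kappa> * f_hat f \<kappa> \<mu> = oct_tr c \<and>
          x = (\<kappa> / oct_tr c) *\<^sub>O (c + (\<mu> * f_check f \<kappa> \<mu>) *\<^sub>O 1)
          \<longrightarrow> oct_tr x = \<kappa> \<and> oct_norm x = - \<mu>)) \<and>
    (CHAR('a) = 2 \<and> oct_tr c = 0 \<longrightarrow>
      (\<forall>x. x \<in> X \<longleftrightarrow> (\<exists>\<mu>.
          \<mu> * (f_hat f 0 \<mu>)\<^sup>2 + \<mu>\<^sup>2 * (f_check f 0 \<mu>)\<^sup>2 = oct_norm c \<and>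
          f_hat f 0 \<mu> \<noteq> 0 \<and>
          x = (1 / f_hat f 0 \<mu>) *\<^sub>O (c + (\<mu> * f_check f 0 \<mu>) *\<^sub>O 1))) \<and>
      (\<forall>x \<mu>.
          \<mu> * (f_hat f 0 \<mu>)\<^sup>2 + \<mu>\<^sup>2 * (f_check f 0 \<mu>)\<^sup>2 = oct_norm c \<and>
          f_hat f 0 \<mu> \<noteq> 0 \<and>
          x = (1 / f_hat f 0 \<mu>) *\<^sub>O (c + (\<mu> * f_check f 0 \<mu>) *\<^sub>O 1)
          \<longrightarrow> oct_tr x = 0 \<and> oct_norm x = - \<mu>))"
proof -
  have X_iff: "\<forall>x. x \<in> X \<longleftrightarrow> (\<exists>\<kappa> \<mu>. oct_sol f c \<kappa> \<mu> x)"
    using X oct_poly_eq_iff_sol[OF c] by simp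
  have tr_norm: "\<forall>x \<kappa> \<mu>. oct_sol f c \<kappa> \<mu> x \<longrightarrow> oct_tr x = \<kappa> \<and> oct_norm x = - \<mu>"
    using oct_sol_tr_norm by blast
  show ?thesis
  proof (rule conjI[OF impI conjI[OF impI impI]], goal_cases)
    case 1
    show ?case
      using X_iff tr_norm unfolding oct_sol_char_not_2[OF 1] by (rule conjI)
  next
    case 2
    show ?case
      using X_iff tr_norm
      unfolding oct_sol_char_2_tr_nonzero[OF conjunct1[OF 2] conjunct2[OF 2]] by (rule conjI)
  next
    case 3
    \<comment> \<open>As \<kappa> = 0 is forced, the existential over \<kappa> collapses.\<close>
    have "\<forall>x. x \<in> X \<longleftrightarrow> (\<exists>\<mu>. oct_sol f c 0 \<mu> x)"
      using X_iff oct_sol_char_2_tr_zero[OF conjunct1[OF 3] conjunct2[OF 3]] by metis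
    moreover have "\<forall>x \<mu>. oct_sol f c 0 \<mu> x \<longrightarrow> oct_tr x = 0 \<and> oct_norm x = - \<mu>"
      using tr_norm by blast
    ultimately show ?case
      \<comment> \<open>At \<kappa> = 0 the rewritten system retains the conjunct
        \<open>0 = 0\<close>, which \<open>simp_thms\<close> removes.\<close>
      unfolding oct_sol_char_2_tr_zero[OF conjunct1[OF 3] conjunct2[OF 3]] simp_thms by (rule conjI)
  qed
qed

end
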